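(* Let $X$ and $Y$ be Polish spaces, with Borel $\sigma$-algebras $\mathscr B(X)$ and $\mathscr B(Y)$, and let $\varphi\colon X\to Y$ be a Borel measurable map. Let $\mathbb B$ be a Banach space and let $\Omega$ be a $\mathbb B$-valued measure on $(X,\mathscr B(X))$ having bounded variation. Suppose that $\{\Omega_y\}_{y\in Y}$ and $\{\Omega'_y\}_{y\in Y}$ are disintegrations of $\Omega$ along $\varphi$. Then $\Omega_y=\Omega'_y$ for $\varphi_\#\|\Omega\|_{\mathbb B}$-a.e. $y\in Y$.
   Context: A $\mathbb B$-valued measure on a measurable space $(X,\Sigma)$ is a map $\Omega\colon\Sigma\to\mathbb B$ that is countably additive in norm. Its variation is $\|\Omega\|_{\mathbb B}(E):=\sup\sum_{i=1}^n\|\Omega(E_i)\|_{\mathbb B}$ over finite measurable partitions $(E_i)_{i=1}^n$ of $E$; $\Omega$ has bounded variation if $\|\Omega\|_{\mathbb B}(X)<+\infty$, in which case $\|\Omega\|_{\mathbb B}$ is a finite measure. For a measurable map $\varphi\colon X\to Y$, $\varphi_\#\|\Omega\|_{\mathbb B}$ is the pushforward measure $E\mapsto\|\Omega\|_{\mathbb B}(\varphi^{-1}(E))$. $\mathcal L^\infty(\Sigma)$ is the Banach space of bounded $\Sigma$-measurable functions $X\to\mathbb R$ with the supremum norm. For $\Omega$ of bounded variation, $f\mapsto\int f\,d\Omega\in\mathbb B$ is the unique linear continuous operator on $\mathcal L^\infty(\Sigma)$ with $\int\mathbf 1_E\,d\Omega=\Omega(E)$ for all $E\in\Sigma$. A map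 from a $\sigma$-finite measure space $(Y,\Sigma_Y,\nu)$ to $\mathbb B$ is strongly measurable if it is $\nu$-measurable (preimages of Borel sets belong to the $\nu$-completion of $\Sigma_Y$) and it is the $\nu$-a.e. norm limit of a sequence of $\mathbb B$-simple maps $\sum_{i=1}^n\mathbf 1_{E_i}v_i$ ($E_i\in\Sigma_Y$ pairwise disjoint, $\nu(E_i)<\infty$, $v_i\in\mathbb B$). Disintegration: let $(X,\Sigma_X)$, $(Y,\Sigma_Y)$ be measurable spaces, $\varphi\colon X\to Y$ measurable, and $\Omega$ a $\mathbb B$-valued measure on $(X,\Sigma_X)$ of bounded variation; put $\nu:=\varphi_\#\|\Omega\|_{\mathbb B}$. A family $\{\Omega_y\}_{y\in Y}$ is a disintegration of $\Omega$ along $\varphi$ if: (i) each $\Omega_y$ is a $\mathbb B$-valued measure on $(X,\Sigma_X)$ of bounded variation, and for $\nu$-a.e. $y\in Y$ one has $\|\Omega_y\|_{\mathbb B}(X)=1$, $\{y\}\in\Sigma_Y$ and $\|\Omega_y\|_{\mathbb B}(X\setminus\varphi^{-1}(\{y\}))=0$; (ii) for every $f\in\mathcal L^\infty(\Sigma_X)$ the map $Y\ni y\mapsto\int f\,d\Omega_y\in\mathbb B$ is strongly measurable with respect to $(Y,\Sigma_Y,\nu)$; (iii) $\int f\,d\Omega=\int_Y\big(\int f\,d\Omega_y\big)\,d\nu(y)$ (Bochner integral) for every $f\in\mathcal L^\infty(\Sigma_X)$. Here $\Sigma_X=\mathscr B(X)$ and $\Sigma_Y=\mathscr B(Y)$.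 *)

theory Defs
  imports "HOL-Analysis.Analysis"
begin

text \<open>
  A vector measure on \<open>M\<close> is a set function of which only the values on \<open>sets M\<close> matter; of \<open>M\<close>
  itself only \<open>space M\<close> and \<open>sets M\<close> are used, so that \<open>M = borel\<close> stands for a topological space
  with its Borel sigma-algebra. Convergence of the series is in norm.
\<close>

definition vector_measure :: "'a measure \<Rightarrow> ('a set \<Rightarrow> 'b::banach) \<Rightarrow> bool" where
  "vector_measure M \<Omega> \<longleftrightarrow>
     (\<forall>A :: nat \<Rightarrow> 'a set. range A \<subseteq> sets M \<longrightarrow> disjoint_family A \<longrightarrow>
        (\<lambda>i. \<Omega> (A i)) sums \<Omega> (\<Union>i. A i))"

text \<open>
  In \<open>partition_on\<close> the cells are nonempty; this is no restriction, as
  \<open>\<Omega> {} = 0\<close> for a vector measure.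
\<close>

definition variation :: "'a measure \<Rightarrow> ('a set \<Rightarrow> 'b::banach) \<Rightarrow> 'a set \<Rightarrow> ennreal" where
  "variation M \<Omega> E =
     (SUP P \<in> {P. finite P \<and> P \<subseteq> sets M \<and> partition_on E P}. \<Sum>A\<in>P. ennreal (norm (\<Omega> A)))"

definition bounded_variation :: "'a measure \<Rightarrow> ('a set \<Rightarrow> 'b::banach) \<Rightarrow> bool" where
  "bounded_variation M \<Omega> \<longleftrightarrow> variation M \<Omega> (space M) < \<infinity>"

definition variation_measure :: "'a measure \<Rightarrow> ('a set \<Rightarrow> 'b::banach) \<Rightarrow> 'a measure" where
  "variation_measure M \<Omega> = measure_of (space M) (sets M) (variation M \<Omega>)"

definition Linf :: "'a measure \<Rightarrow> ('a \<Rightarrow> real) set" where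
  "Linf M = {f. f \<in> borel_measurable M \<and> bounded (f ` space M)}"

text \<open>The inserted \<open>0\<close> only serves to give the norm the value \<open>0\<close> on an empty space.\<close>

definition supnorm :: "'a measure \<Rightarrow> ('a \<Rightarrow> real) \<Rightarrow> real" where
  "supnorm M f = Sup (insert 0 ((\<lambda>x. \<bar>f x\<bar>) ` space M))"

definition linear_on_Linf :: "'a measure \<Rightarrow> (('a \<Rightarrow> real) \<Rightarrow> 'b::banach) \<Rightarrow> bool" where
  "linear_on_Linf M T \<longleftrightarrow>
     (\<forall>f\<in>Linf M. \<forall>g\<in>Linf M. T (\<lambda>x. f x + g x) = T f + T g) \<and>
     (\<forall>c. \<forall>f\<in>Linf M. T (\<lambda>x. c * f x) = c *\<^sub>R T f)"

definition continuous_on_Linf :: "'a measure \<Rightarrow> (('a \<Rightarrow> real) \<Rightarrow> 'b::banach) \<Rightarrow> bool" where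
  "continuous_on_Linf M T \<longleftrightarrow>
     (\<forall>f\<in>Linf M. \<forall>\<epsilon>>0. \<exists>\<delta>>0. \<forall>g\<in>Linf M.
        supnorm M (\<lambda>x. g x - f x) < \<delta> \<longrightarrow> norm (T g - T f) < \<epsilon>)"

text \<open>
  The integral is the unique continuous linear operator on \<open>Linf M\<close> extending \<open>\<Omega>\<close>; membership in
  \<open>extensional\<close> fixes its irrelevant values outside \<open>Linf M\<close>, which uniqueness in HOL requires.
\<close>

definition vector_integral ::
    "'a measure \<Rightarrow> ('a set \<Rightarrow> 'b::banach) \<Rightarrow> ('a \<Rightarrow> real) \<Rightarrow> 'b" where
  "vector_integral M \<Omega> =
     (THE T. T \<in> extensional (Linf M) \<and> linear_on_Linf M T \<and> continuous_on_Linf M T \<and>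
        (\<forall>E\<in>sets M. T (indicator E) = \<Omega> E))"

text \<open>
  The Banach space need not be separable, whereas the Bochner integral of the library is restricted
  to second countable spaces. The library's \<open>simple_bochner_integrable\<close> and
  \<open>simple_bochner_integral\<close> are not: the former describes exactly the finite sums of vectors times
  indicators of pairwise disjoint measurable sets of finite measure, the latter their integral.
\<close>

definition strongly_measurable :: "'a measure \<Rightarrow> ('a \<Rightarrow> 'b::banach) \<Rightarrow> bool" where
  "strongly_measurable N f \<longleftrightarrow>
     f \<in> borel_measurable (completion N) \<and>
     (\<exists>s :: nat \<Rightarrow> 'a \<Rightarrow> 'b. (\<forall>i. Bochner_Integration.simple_bochner_integrable N (s i)) \<and>
        (AE y in N. (\<lambda>i. s i y) \<longlonglongrightarrow> f y))"

text \<open>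
  As \<open>has_bochner_integral\<close> in the library, but for strongly measurable functions. The norm is integrated
  over the completion because \<open>f\<close> is only measurable with respect to it.
\<close>

definition has_Bochner_integral :: "'a measure \<Rightarrow> ('a \<Rightarrow> 'b::banach) \<Rightarrow> 'b \<Rightarrow> bool" where
  "has_Bochner_integral N f v \<longleftrightarrow>
     strongly_measurable N f \<and>
     (\<exists>s :: nat \<Rightarrow> 'a \<Rightarrow> 'b. (\<forall>i. Bochner_Integration.simple_bochner_integrable N (s i)) \<and>
        (\<lambda>i. \<integral>\<^sup>+ y. ennreal (norm (f y - s i y)) \<partial>completion N) \<longlonglongrightarrow> 0 \<and>
        (\<lambda>i. Bochner_Integration.simple_bochner_integral N (s i)) \<longlonglongrightarrow> v)"

definition disintegration ::
    "'x measure \<Rightarrow> 'y measure \<Rightarrow> ('x \<Rightarrow> 'y) \<Rightarrow> ('x set \<Rightarrow> 'b::banach) \<Rightarrow> ('y \<Rightarrow> 'x set \<Rightarrow> 'b) \<Rightarrow> bool"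
where
  "disintegration X Y \<phi> \<Omega> \<Omega>y \<longleftrightarrow>
     (let \<nu> = distr (variation_measure X \<Omega>) Y \<phi> in
       (\<forall>y\<in>space Y. vector_measure X (\<Omega>y y) \<and> bounded_variation X (\<Omega>y y)) \<and>
       (AE y in \<nu>. variation X (\<Omega>y y) (space X) = 1 \<and> {y} \<in> sets Y \<and>
          variation X (\<Omega>y y) (space X - \<phi> -` {y}) = 0) \<and>
       (\<forall>f\<in>Linf X. strongly_measurable \<nu> (\<lambda>y. vector_integral X (\<Omega>y y) f)) \<and>
       (\<forall>f\<in>Linf X. has_Bochner_integral \<nu> (\<lambda>y. vector_integral X (\<Omega>y y) f)
          (vector_integral X \<Omega> f)))"

end

theory Submission
  imports Defs
begin

text \<open>
  Fix a Borel set \<open>E\<close>. Testing the disintegration formula with the indicator of \<open>E \<inter> \<phi> -` F\<close> and using that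
  \<open>\<Omega>\<^sub>y\<close> is concentrated on the fibre over \<open>y\<close> shows that the integral of \<open>y \<mapsto> \<Omega>\<^sub>y E\<close> over any Borel set \<open>F\<close>
  is \<open>\<Omega> (E \<inter> \<phi> -` F)\<close>; hence \<open>\<Omega>\<^sub>y E\<close> is determined for almost every \<open>y\<close>. Taking \<open>E\<close> in a countable
  intersection-stable generator of the Borel sets makes the exceptional null set independent of \<open>E\<close>, and
  Dynkin's theorem extends the equality to all Borel sets.
\<close>

subsection \<open>Vector measures\<close>

text \<open>Countable additivity for the constant sequence of empty sets makes a series with
  constant terms converge, and the terms of a convergent series tend to zero.\<close>

lemma vector_measure_empty:
  assumes "vector_measure M \<Omega>"
  shows "\<Omega> {} = 0"
proof -
  have "(\<lambda>i::nat. \<Omega> {}) sums \<Omega> (\<Union>i::nat. {})"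
    using assms unfolding vector_measure_def
    by (elim allE[of _ "\<lambda>_. {}"]) (auto simp: disjoint_family_on_def)
  then have "(\<lambda>i::nat. \<Omega> {}) \<longlonglongrightarrow> 0"
    by (intro summable_LIMSEQ_zero sums_summable)
  then show ?thesis by (simp add: LIMSEQ_const_iff)
qed

lemma vector_measure_Un:
  assumes "vector_measure M \<Omega>" "A \<in> sets M" "B \<in> sets M" "A \<inter> B = {}"
  shows "\<Omega> (A \<union> B) = \<Omega> A + \<Omega> B"
proof -
  have "disjoint_family (binaryset A B)"
    using assms by (auto simp: disjoint_family_on_def binaryset_def)
  then have "(\<lambda>i. \<Omega> (binaryset A B i)) sums \<Omega> (\<Union>i. binaryset A B i)"
    using assms unfolding vector_measure_def
    by (elim allE[of _ "binaryset A B"]) (auto simp: range_binaryset_eq)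
  moreover have "(\<lambda>i. \<Omega> (binaryset A B i)) sums (\<Omega> A + \<Omega> B)"
    by (rule binaryset_sums) (rule vector_measure_empty[OF assms(1)])
  ultimately show ?thesis
    by (simp add: UN_binaryset_eq sums_unique2)
qed

lemma vector_measure_Diff:
  assumes "vector_measure M \<Omega>" "A \<in> sets M" "B \<in> sets M" "B \<subseteq> A"
  shows "\<Omega> (A - B) = \<Omega> A - \<Omega> B"
proof -
  have "\<Omega> ((A - B) \<union> B) = \<Omega> (A - B) + \<Omega> B"
    using assms by (intro vector_measure_Un) auto
  moreover have "(A - B) \<union> B = A" using assms by auto
  ultimately show ?thesis by simp
qed

lemma vector_measure_finite_UN:
  assumes "vector_measure M \<Omega>" "finite I" "\<And>i. i \<in> I \<Longrightarrow> A i \<in> sets M" "disjoint_family_on A I"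
  shows "\<Omega> (\<Union>i\<in>I. A i) = (\<Sum>i\<in>I. \<Omega> (A i))"
  using assms(2-)
proof (induction I rule: finite_induct)
  case empty
  then show ?case by (simp add: vector_measure_empty[OF assms(1)])
next
  case (insert i I)
  have "\<Omega> (A i \<union> (\<Union>i\<in>I. A i)) = \<Omega> (A i) + \<Omega> (\<Union>i\<in>I. A i)"
    using insert by (intro vector_measure_Un[OF assms(1)]) (auto simp: disjoint_family_on_def)
  moreover have "\<Omega> (\<Union>i\<in>I. A i) = (\<Sum>i\<in>I. \<Omega> (A i))"
    using insert by (intro insert.IH) (auto simp: disjoint_family_on_def)
  ultimately show ?case using insert by simp
qed

lemma norm_le_variation:
  assumes "vector_measure M \<Omega>" "A \<in> sets M" "E \<in> sets M" "A \<subseteq> E"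
  shows "ennreal (norm (\<Omega> A)) \<le> variation M \<Omega> E"
proof (cases "A = {}")
  case True
  then show ?thesis by (simp add: vector_measure_empty[OF assms(1)])
next
  case False
  \<comment> \<open>Cells of a partition are nonempty, so the empty set has to be removed in case
    \<open>A = E\<close>.\<close>
  let ?P = "{A, E - A} - {{}}"
  have "?P \<in> {P. finite P \<and> P \<subseteq> sets M \<and> partition_on E P}"
    using assms by (auto simp: partition_on_def disjoint_def)
  then have "(\<Sum>A\<in>?P. ennreal (norm (\<Omega> A))) \<le> variation M \<Omega> E"
    unfolding variation_def by (rule SUP_upper)
  moreover have "(\<Sum>A\<in>{A}. ennreal (norm (\<Omega> A))) \<le> (\<Sum>A\<in>?P. ennreal (norm (\<Omega> A)))"
    using False by (intro sum_mono2) auto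
  ultimately show ?thesis by simp
qed

section \<open>Agreement of vector measures on a countable generator\<close>

lemma borel_countable_Int_stable_generator:
  obtains G :: "'a::second_countable_topology set set"
  where "countable G" "Int_stable G" "UNIV \<in> G" "sets borel = sigma_sets UNIV G"
proof -
  obtain B :: "'a set set" where B: "countable B" "topological_basis B"
    using ex_countable_basis by auto
  \<comment> \<open>Finite intersections of basis sets are open, still countably many, and closed
    under intersection; the empty intersection supplies \<open>UNIV\<close>.\<close>
  define G where "G = Inter ` {F. finite F \<and> F \<subseteq> B}"
  show thesis
  proof
    show "countable G"
      unfolding G_def using B(1) by (intro countable_image countable_Collect_finite_subset)
    show "Int_stable G"
    proof (rule Int_stableI)
      fix a b assume "a \<in> G" "b \<in> G"
      then obtain F F' where "finite F" "F \<subseteq> B" "a = \<Inter>F" "finite F'" "F' \<subseteq> B" "b = \<Inter>F'"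
        by (auto simp: G_def)
      then show "a \<inter> b \<in> G"
        unfolding G_def by (intro image_eqI[of _ _ "F \<union> F'"]) auto
    qed
    show "UNIV \<in> G" unfolding G_def by (intro image_eqI[of _ _ "{}"]) auto
    have BG: "B \<subseteq> G"
    proof
      fix b assume "b \<in> B"
      then show "b \<in> G" unfolding G_def by (intro image_eqI[of _ _ "{b}"]) auto
    qed
    have "open U" if "U \<in> G" for U
      using that B(2) by (auto simp: G_def intro!: open_Inter dest: topological_basis_open)
    then have "sigma_sets UNIV G \<subseteq> sets borel"
      using sets.sigma_sets_subset[of G borel] by (simp add: subset_iff)
    moreover have "sets borel = sigma_sets UNIV B"
      unfolding borel_eq_countable_basis[OF B] by (rule sets_measure_of) simp
    moreover have "sigma_sets UNIV B \<subseteq> sigma_sets UNIV G"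
      using BG by (rule sigma_sets_mono')
    ultimately show "sets borel = sigma_sets UNIV G" by simp
  qed
qed

text \<open>Dynkin's argument: the sets on which both measures agree are closed under countable
  disjoint unions by additivity, and under complements because the whole space belongs to
  \<open>G\<close>.\<close>

lemma vector_measure_eqI_generator:
  assumes "vector_measure M \<Omega>" "vector_measure M \<Omega>'"
    and G: "Int_stable G" "G \<subseteq> Pow (space M)" "space M \<in> G" "sets M = sigma_sets (space M) G"
    and eq: "\<And>A. A \<in> G \<Longrightarrow> \<Omega> A = \<Omega>' A"
    and E: "E \<in> sets M"
  shows "\<Omega> E = \<Omega>' E"
proof -
  have "E \<in> sigma_sets (space M) G" using E G by simp
  with G(1,2) show ?thesis
  proof (induction rule: sigma_sets_induct_disjoint)
    case (basic A)
    then show ?case by (rule eq)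
  next
    case empty
    then show ?case using assms by (simp add: vector_measure_empty)
  next
    case (compl A)
    then have "A \<in> sets M" using G(4) by simp
    then show ?case
      using compl.IH assms(1,2) eq[OF G(3)]
      by (simp add: vector_measure_Diff sets.sets_into_space)
  next
    case (union A)
    have "(\<lambda>i. \<Omega> (A i)) sums \<Omega> (\<Union>i. A i)" "(\<lambda>i. \<Omega>' (A i)) sums \<Omega>' (\<Union>i. A i)"
      using union.hyps assms(1,2) G(4) unfolding vector_measure_def by auto
    then show ?case using union.IH by (simp add: sums_unique2)
  qed
qed

subsection \<open>The integral of bounded functions\<close>

definition simple_vector_integral :: "'a measure \<Rightarrow> ('a set \<Rightarrow> 'b::banach) \<Rightarrow> ('a \<Rightarrow> real) \<Rightarrow> 'b" where
  "simple_vector_integral M \<Omega> s = (\<Sum>r\<in>s ` space M. r *\<^sub>R \<Omega> {x\<in>space M. s x = r})"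

lemma simple_function_level_set :
  "simple_function M s \<Longrightarrow> {x\<in>space M. s x = r} \<in> sets M"
  using simple_functionD(2)[of M s "{r}"] by (simp add: vimage_def Int_def conj_commute)

text \<open>Grouping the level sets of \<open>g\<close> by the value of \<open>v\<close> and merging
  each group by finite additivity gives the level sets of \<open>f\<close>. This allows several
  simple functions to be integrated over one common refinement.\<close>

lemma simple_vector_integral_partition:
  assumes "vector_measure M \<Omega>" "simple_function M f" "simple_function M g"
    and v: "\<And>x. x \<in> space M \<Longrightarrow> f x = v (g x)"
  shows "simple_vector_integral M \<Omega> f = (\<Sum>z\<in>g ` space M. v z *\<^sub>R \<Omega> {x\<in>space M. g x = z})"
proof -
  have fin: "finite (g ` space M)" using assms by (simp add: simple_functionD)
  have im: "v ` g ` space M = f ` space M" using v by (auto simp: image_iff)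
  have "(\<Sum>z\<in>g ` space M. v z *\<^sub>R \<Omega> {x\<in>space M. g x = z}) =
      (\<Sum>r\<in>f ` space M. \<Sum>z\<in>{z\<in>g ` space M. v z = r}. v z *\<^sub>R \<Omega> {x\<in>space M. g x = z})"
    using sum.image_gen[OF fin, of "\<lambda>z. v z *\<^sub>R \<Omega> {x\<in>space M. g x = z}" v] by (simp only: im)
  also have "\<dots> = (\<Sum>r\<in>f ` space M. r *\<^sub>R \<Omega> {x\<in>space M. f x = r})"
  proof (rule sum.cong[OF refl])
    fix r
    let ?Z = "{z\<in>g ` space M. v z = r}"
    have "{x\<in>space M. f x = r} = (\<Union>z\<in>?Z. {x\<in>space M. g x = z})"
      using v by auto
    moreover have "\<Omega> (\<Union>z\<in>?Z. {x\<in>space M. g x = z}) = (\<Sum>z\<in>?Z. \<Omega> {x\<in>space M. g x = z})"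
      using fin assms
      by (intro vector_measure_finite_UN) (auto simp: disjoint_family_on_def simple_function_level_set)
    ultimately show "(\<Sum>z\<in>?Z. v z *\<^sub>R \<Omega> {x\<in>space M. g x = z}) = r *\<^sub>R \<Omega> {x\<in>space M. f x = r}"
      by (simp add: scaleR_sum_right)
  qed
  finally show ?thesis by (simp add: simple_vector_integral_def)
qed

lemma simple_vector_integral_add:
  assumes "vector_measure M \<Omega>" and [simp]: "simple_function M f" "simple_function M g"
  shows "simple_vector_integral M \<Omega> (\<lambda>x. f x + g x) =
    simple_vector_integral M \<Omega> f + simple_vector_integral M \<Omega> g"
proof -
  \<comment> \<open>The level sets of the pair refine those of \<open>f\<close>, of \<open>g\<close>
    and of their sum at once.\<close>
  let ?h = "\<lambda>x. (f x, g x)"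
  note p = simple_vector_integral_partition[OF assms(1), where g = ?h]
  show ?thesis
    using p[of "\<lambda>x. f x + g x" "\<lambda>z. fst z + snd z"] p[of f fst] p[of g snd]
    by (simp add: simple_function_Pair sum.distrib[symmetric] scaleR_add_left)
qed

lemma simple_vector_integral_scale:
  assumes "vector_measure M \<Omega>" and [simp]: "simple_function M f"
  shows "simple_vector_integral M \<Omega> (\<lambda>x. c * f x) = c *\<^sub>R simple_vector_integral M \<Omega> f"
  using simple_vector_integral_partition[OF assms(1), where g = f and f = "\<lambda>x. c * f x" and v = "\<lambda>z. c * z"]
  by (simp add: simple_vector_integral_def scaleR_sum_right simple_function_mult)

lemma simple_vector_integral_indicator:
  assumes "vector_measure M \<Omega>" "E \<in> sets M"
  shows "simple_vector_integral M \<Omega> (indicator E) = \<Omega> E"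
proof -
  have E: "{x\<in>space M. indicator E x = (1::real)} = E"
    using sets.sets_into_space[OF assms(2)] by (auto simp: indicator_def)
  have "simple_vector_integral M \<Omega> (indicator E) =
      (\<Sum>r\<in>{0, 1}. r *\<^sub>R \<Omega> {x\<in>space M. indicator E x = r})"
    \<comment> \<open>An indicator may miss one of the values 0 and 1. A missing 0 contributes
      nothing by its factor; a missing 1 means that \<open>E\<close> is empty, where
      \<open>\<Omega>\<close> vanishes.\<close>
    unfolding simple_vector_integral_def
  proof (intro sum.mono_neutral_left)
    have "E = {}" if "1 \<notin> (indicator E::_\<Rightarrow>real) ` space M"
      using that E by (auto simp: image_iff)
    then have "\<Omega> {x \<in> space M. indicator E x = (1::real)} = 0" if "1 \<notin> (indicator E::_\<Rightarrow>real) ` space M"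
      using E that vector_measure_empty[OF assms(1)] by simp
    then show "\<forall>i\<in>{0, 1} - (indicator E) ` space M. i *\<^sub>R \<Omega> {x \<in> space M. indicator E x = i} = 0"
      by (metis DiffE insertE scaleR_zero_left scaleR_zero_right singletonD)
  qed (auto simp: indicator_def)
  then show ?thesis using E by simp
qed

lemma norm_simple_vector_integral_le:
  assumes "bounded_variation M \<Omega>" "simple_function M s" "0 \<le> C" "\<And>x. x \<in> space M \<Longrightarrow> \<bar>s x\<bar> \<le> C"
  shows "norm (simple_vector_integral M \<Omega> s) \<le> C * enn2real (variation M \<Omega> (space M))"
proof -
  let ?A = "\<lambda>r. {x\<in>space M. s x = r}"
  let ?P = "?A ` s ` space M"
  have fin: "finite (s ` space M)" using assms by (simp add: simple_functionD)
  \<comment> \<open>Only attained values are considered, so the level sets are nonempty and distinct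
    values have distinct ones; the sum over cells becomes a sum over values.\<close>
  have inj: "inj_on ?A (s ` space M)" by (auto simp: inj_on_def)
  have "?P \<in> {P. finite P \<and> P \<subseteq> sets M \<and> partition_on (space M) P}"
    using fin assms by (auto simp: partition_on_def disjoint_def simple_function_level_set)
  then have "(\<Sum>A\<in>?P. ennreal (norm (\<Omega> A))) \<le> variation M \<Omega> (space M)"
    unfolding variation_def by (rule SUP_upper)
  then have "ennreal (\<Sum>r\<in>s ` space M. norm (\<Omega> (?A r))) \<le> variation M \<Omega> (space M)"
    by (simp add: sum.reindex[OF inj] o_def sum_ennreal)
  then have V: "(\<Sum>r\<in>s ` space M. norm (\<Omega> (?A r))) \<le> enn2real (variation M \<Omega> (space M))"
    using assms(1) unfolding bounded_variation_def
    by (cases "variation M \<Omega> (space M)") (auto simp: ennreal_le_iff)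
  have "norm (simple_vector_integral M \<Omega> s) \<le> (\<Sum>r\<in>s ` space M. norm (r *\<^sub>R \<Omega> (?A r)))"
    unfolding simple_vector_integral_def by (rule norm_sum)
  also have "\<dots> \<le> (\<Sum>r\<in>s ` space M. C * norm (\<Omega> (?A r)))"
    using assms by (intro sum_mono) (auto intro!: mult_right_mono)
  also have "\<dots> = C * (\<Sum>r\<in>s ` space M. norm (\<Omega> (?A r)))" by (simp add: sum_distrib_left)
  also have "\<dots> \<le> C * enn2real (variation M \<Omega> (space M))"
    using V assms by (intro mult_left_mono)
  finally show ?thesis .
qed

lemma norm_simple_vector_integral_diff_le:
  assumes "vector_measure M \<Omega>" "bounded_variation M \<Omega>"
    and [simp]: "simple_function M s" "simple_function M t"
    and "0 \<le> C" "\<And>x. x \<in> space M \<Longrightarrow> \<bar>s x - t x\<bar> \<le> C"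
  shows "norm (simple_vector_integral M \<Omega> s - simple_vector_integral M \<Omega> t)
    \<le> C * enn2real (variation M \<Omega> (space M))"
proof -
  have "simple_vector_integral M \<Omega> (\<lambda>x. s x + (-1) * t x) =
      simple_vector_integral M \<Omega> s - simple_vector_integral M \<Omega> t"
    using assms(1) by (subst simple_vector_integral_add)
      (simp_all only: simple_vector_integral_scale simple_function_mult simple_function_const
        simple_function_compose1 assms(3,4), simp)
  then show ?thesis
    using norm_simple_vector_integral_le[OF assms(2), of "\<lambda>x. s x + (-1) * t x" C] assms(5,6)
    by (simp add: simple_function_diff)
qed

section \<open>Uniform approximation and the supremum norm\<close>

lemma Linf_approx_simple:
  assumes "f \<in> Linf M" "0 < (e::real)"
  obtains s where "simple_function M s" "\<And>x. x \<in> space M \<Longrightarrow> \<bar>s x - f x\<bar> \<le> e"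
proof
  \<comment> \<open>Rounding \<open>f\<close> down to the multiples of \<open>e\<close> costs less
    than \<open>e\<close>; boundedness of \<open>f\<close> leaves finitely many values.\<close>
  let ?s = "\<lambda>x. e * of_int \<lfloor>f x / e\<rfloor>"
  have f [measurable]: "f \<in> borel_measurable M" using assms by (simp add: Linf_def)
  obtain C where C: "\<And>x. x \<in> space M \<Longrightarrow> \<bar>f x\<bar> \<le> C"
    using assms by (auto simp: Linf_def bounded_iff)
  have "\<lfloor>f x / e\<rfloor> \<in> {\<lfloor>- C / e\<rfloor>..\<lfloor>C / e\<rfloor>}" if "x \<in> space M" for x
  proof -
    have "- C / e \<le> f x / e" "f x / e \<le> C / e"
      using C[OF that] \<open>0 < e\<close> by (intro divide_right_mono; linarith)+
    then show ?thesis by (simp only: atLeastAtMost_iff floor_mono)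
  qed
  then have "?s ` space M \<subseteq> (\<lambda>k. e * of_int k) ` {\<lfloor>- C / e\<rfloor>..\<lfloor>C / e\<rfloor>}"
    by blast
  then have "finite (?s ` space M)" by (rule finite_subset) simp
  then show "simple_function M ?s"
    by (intro simple_function_borel_measurable) auto
  fix x
  have "f x / e < of_int \<lfloor>f x / e\<rfloor> + 1" "of_int \<lfloor>f x / e\<rfloor> \<le> f x / e" by linarith+
  then have "f x < e * of_int \<lfloor>f x / e\<rfloor> + e" "e * of_int \<lfloor>f x / e\<rfloor> \<le> f x"
    using \<open>0 < e\<close> by (simp_all only: pos_divide_less_eq pos_le_divide_eq distrib_left distrib_right mult.commute mult_1_left)
  then show "\<bar>?s x - f x\<bar> \<le> e"
    using \<open>0 < e\<close> by linarith
qed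

lemma Linf_add: "f \<in> Linf M \<Longrightarrow> g \<in> Linf M \<Longrightarrow> (\<lambda>x. f x + g x) \<in> Linf M"
  by (auto simp: Linf_def intro: bounded_plus_comp)

lemma Linf_cmult: "f \<in> Linf M \<Longrightarrow> (\<lambda>x. c * f x) \<in> Linf M"
  using bounded_scaling[of "f ` space M" c] by (auto simp: Linf_def image_image)

lemma Linf_diff: "f \<in> Linf M \<Longrightarrow> g \<in> Linf M \<Longrightarrow> (\<lambda>x. f x - g x) \<in> Linf M"
  using Linf_add[of f M "\<lambda>x. (-1) * g x"] Linf_cmult[of g M "-1"] by simp

lemma Linf_indicator: "E \<in> sets M \<Longrightarrow> indicator E \<in> Linf M"
  by (auto simp: Linf_def bounded_iff indicator_def intro!: exI[of _ 1])

lemma abs_le_supnorm: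
  assumes "f \<in> Linf M" "x \<in> space M"
  shows "\<bar>f x\<bar> \<le> supnorm M f"
  unfolding supnorm_def
proof (rule cSup_upper)
  obtain C where "\<And>x. x \<in> space M \<Longrightarrow> \<bar>f x\<bar> \<le> C"
    using assms by (auto simp: Linf_def bounded_iff)
  then show "bdd_above (insert 0 ((\<lambda>x. \<bar>f x\<bar>) ` space M))"
    by (intro bdd_aboveI[of _ "max 0 C"]) (auto simp: le_max_iff_disj)
qed (use assms in auto)

lemma supnorm_le:
  assumes "0 \<le> C" "\<And>x. x \<in> space M \<Longrightarrow> \<bar>f x\<bar> \<le> C"
  shows "supnorm M f \<le> C"
  unfolding supnorm_def using assms by (intro cSup_least) auto

section \<open>Continuous linear extension of the elementary integral\<close>

text \<open>The value \<open>v\<close> is the limit of the elementary integrals along a uniformly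
  convergent sequence of simple functions. The estimate against every simple \<open>s\<close> frees
  it from the chosen sequence and is the source of linearity and continuity below.\<close>

lemma ex_vector_integral_value:
  assumes \<Omega>: "vector_measure M \<Omega>" "bounded_variation M \<Omega>" and f: "f \<in> Linf M"
  shows "\<exists>v. \<forall>s C. simple_function M s \<longrightarrow> 0 \<le> C \<longrightarrow> (\<forall>x\<in>space M. \<bar>s x - f x\<bar> \<le> C) \<longrightarrow>
    norm (v - simple_vector_integral M \<Omega> s) \<le> C * enn2real (variation M \<Omega> (space M))"
proof -
  define V where "V = enn2real (variation M \<Omega> (space M))"
  have V: "0 \<le> V" by (simp add: V_def)
  have "\<exists>s. simple_function M s \<and> (\<forall>x\<in>space M. \<bar>s x - f x\<bar> \<le> inverse (Suc n))" for n
    by (rule Linf_approx_simple[OF f, of "inverse (Suc n)"]) auto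
  then obtain s where s: "\<And>n. simple_function M (s n)"
      "\<And>n x. x \<in> space M \<Longrightarrow> \<bar>s n x - f x\<bar> \<le> inverse (Suc n)"
    by metis
  let ?S = "simple_vector_integral M \<Omega>"
  \<comment> \<open>Both functions are compared with \<open>f\<close>, so their uniform distance is
    at most the sum of the two errors. Taking another \<open>s m\<close> for \<open>t\<close> gives
    the Cauchy property; letting \<open>n\<close> grow gives the estimate for
    \<open>v\<close>.\<close>
  have close: "norm (?S t - ?S (s n)) \<le> (C + inverse (Suc n)) * V"
    if t: "simple_function M t" "0 \<le> C" "\<And>x. x \<in> space M \<Longrightarrow> \<bar>t x - f x\<bar> \<le> C" for t C n
    unfolding V_def
  proof (rule norm_simple_vector_integral_diff_le[OF \<Omega> t(1) s(1)])
    fix x assume x: "x \<in> space M"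
    show "\<bar>t x - s n x\<bar> \<le> C + inverse (Suc n)"
      using t(3)[OF x] s(2)[OF x, of n] by linarith
  qed (use t in auto)
  have lim: "(\<lambda>n. inverse (real (Suc n))) \<longlonglongrightarrow> 0" by (rule LIMSEQ_inverse_real_of_nat)
  have "Cauchy (\<lambda>n. ?S (s n))"
  proof (rule metric_CauchyI)
    fix e :: real assume e: "0 < e"
    have "(\<lambda>n. inverse (real (Suc n)) * (2 * V)) \<longlonglongrightarrow> 0 * (2 * V)"
      by (intro tendsto_intros lim)
    then obtain N where N: "\<And>n. n \<ge> N \<Longrightarrow> inverse (real (Suc n)) * (2 * V) < e"
      using e V by (auto simp: LIMSEQ_def dist_norm)
    have "dist (?S (s m)) (?S (s n)) < e" if mn: "m \<ge> N" "n \<ge> N" for m n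
    proof -
      have "norm (?S (s m) - ?S (s n)) \<le> (inverse (Suc m) + inverse (Suc n)) * V"
        using s by (intro close) auto
      also have "\<dots> \<le> (inverse (Suc N) + inverse (Suc N)) * V"
        using mn V by (intro mult_right_mono add_mono le_imp_inverse_le) auto
      also have "\<dots> < e" using N[of N] by simp
      finally show ?thesis by (simp add: dist_norm)
    qed
    then show "\<exists>N. \<forall>m\<ge>N. \<forall>n\<ge>N. dist (?S (s m)) (?S (s n)) < e" by blast
  qed
  then obtain v where v: "(\<lambda>n. ?S (s n)) \<longlonglongrightarrow> v"
    using Cauchy_convergent_iff convergent_def by blast
  have "norm (v - ?S t) \<le> C * V"
    if t: "simple_function M t" "0 \<le> C" "\<forall>x\<in>space M. \<bar>t x - f x\<bar> \<le> C" for t C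
  proof (rule LIMSEQ_le)
    show "(\<lambda>n. norm (?S (s n) - ?S t)) \<longlonglongrightarrow> norm (v - ?S t)"
      by (intro tendsto_intros v)
    have "(\<lambda>n. (C + inverse (real (Suc n))) * V) \<longlonglongrightarrow> (C + 0) * V"
      by (intro tendsto_intros lim)
    then show "(\<lambda>n. (C + inverse (real (Suc n))) * V) \<longlonglongrightarrow> C * V" by simp
    show "\<exists>N. \<forall>n\<ge>N. norm (?S (s n) - ?S t) \<le> (C + inverse (real (Suc n))) * V"
      using close[of t C] t by (auto simp: norm_minus_commute)
  qed
  then show ?thesis unfolding V_def by blast
qed

text \<open>Linearity forces the values on finite combinations of indicators. Membership in
  \<open>Linf M\<close> is carried through the induction because additivity is available only
  there.\<close>

lemma linear_on_Linf_simple: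
  assumes T: "linear_on_Linf M T" and E: "\<And>E. E \<in> sets M \<Longrightarrow> T (indicator E) = \<Omega> E"
    and "finite R" "\<And>r. r \<in> R \<Longrightarrow> A r \<in> sets M"
  shows "(\<lambda>x. \<Sum>r\<in>R. c r * indicator (A r) x) \<in> Linf M \<and>
    T (\<lambda>x. \<Sum>r\<in>R. c r * indicator (A r) x) = (\<Sum>r\<in>R. c r *\<^sub>R \<Omega> (A r))"
  using assms(3,4)
proof (induction R rule: finite_induct)
  case empty
  \<comment> \<open>The zero function is written as a multiple of an indicator, so that homogeneity
    yields its image.\<close>
  have "(\<lambda>x. 0 * indicator {} x) \<in> Linf M"
    by (intro Linf_cmult Linf_indicator) simp
  moreover have "T (\<lambda>x. 0 * indicator {} x) = 0 *\<^sub>R T (indicator {})"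
    using T Linf_indicator[of "{}" M] unfolding linear_on_Linf_def by blast
  ultimately show ?case by simp
next
  case (insert r R)
  have 1: "(\<lambda>x. c r * indicator (A r) x) \<in> Linf M"
    using insert by (intro Linf_cmult Linf_indicator) auto
  have "T (\<lambda>x. c r * indicator (A r) x) = c r *\<^sub>R \<Omega> (A r)"
    using T E[of "A r"] Linf_indicator[of "A r" M] insert unfolding linear_on_Linf_def by auto
  moreover have IH: "(\<lambda>x. \<Sum>r\<in>R. c r * indicator (A r) x) \<in> Linf M"
      "T (\<lambda>x. \<Sum>r\<in>R. c r * indicator (A r) x) = (\<Sum>r\<in>R. c r *\<^sub>R \<Omega> (A r))"
    using insert by blast+
  moreover have "T (\<lambda>x. c r * indicator (A r) x + (\<Sum>r\<in>R. c r * indicator (A r) x)) =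
      T (\<lambda>x. c r * indicator (A r) x) + T (\<lambda>x. \<Sum>r\<in>R. c r * indicator (A r) x)"
    by (rule T[unfolded linear_on_Linf_def, THEN conjunct1, rule_format, OF 1 IH(1)])
  ultimately show ?case
    using Linf_add[OF 1 IH(1)] by (simp only: sum.insert[OF insert.hyps] simp_thms)
qed

lemma simple_function_eq_sum_indicator:
  fixes s :: "'a \<Rightarrow> real"
  assumes "simple_function M s" "x \<in> space M"
  shows "(\<Sum>r\<in>s ` space M. r * indicator {x\<in>space M. s x = r} x) = s x"
proof -
  have "(\<Sum>r\<in>s ` space M. r * indicator {x\<in>space M. s x = r} x) = (\<Sum>r\<in>s ` space M. if r = s x then r else 0)"
    using assms by (intro sum.cong) (auto simp: indicator_def)
  then show ?thesis using assms by (simp add: simple_functionD sum.delta)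
qed

text \<open>The two operators coincide on combinations of indicators, which are dense in
  \<open>Linf M\<close> for the supremum norm, and continuity extends the agreement to
  \<open>f\<close>.\<close>

lemma continuous_linear_on_Linf_unique:
  assumes T: "linear_on_Linf M T" "continuous_on_Linf M T" "\<And>E. E \<in> sets M \<Longrightarrow> T (indicator E) = \<Omega> E"
    and T': "linear_on_Linf M T'" "continuous_on_Linf M T'" "\<And>E. E \<in> sets M \<Longrightarrow> T' (indicator E) = \<Omega> E"
    and f: "f \<in> Linf M"
  shows "T f = T' f"
proof -
  have "norm (T f - T' f) \<le> 0 + e" if "e > 0" for e
  proof -
    obtain d where d: "d > 0" "\<And>g. g \<in> Linf M \<Longrightarrow> supnorm M (\<lambda>x. g x - f x) < d \<Longrightarrow> norm (T g - T f) < e / 2"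
      using T(2) f \<open>e > 0\<close> unfolding continuous_on_Linf_def by (meson half_gt_zero)
    obtain d' where d': "d' > 0" "\<And>g. g \<in> Linf M \<Longrightarrow> supnorm M (\<lambda>x. g x - f x) < d' \<Longrightarrow> norm (T' g - T' f) < e / 2"
      using T'(2) f \<open>e > 0\<close> unfolding continuous_on_Linf_def by (meson half_gt_zero)
    obtain s where s: "simple_function M s" "\<And>x. x \<in> space M \<Longrightarrow> \<bar>s x - f x\<bar> \<le> min d d' / 2"
      using Linf_approx_simple[OF f, of "min d d' / 2"] d d' by auto
    \<comment> \<open>\<open>g\<close> equals \<open>s\<close> on \<open>space M\<close>, but may
      differ from it outside; its form as a sum of indicators is the one to which linearity
      applies.\<close>
    define g where "g x = (\<Sum>r\<in>s ` space M. r * indicator {x\<in>space M. s x = r} x)" for x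
    have fin: "finite (s ` space M)" and lev: "\<And>r. {x\<in>space M. s x = r} \<in> sets M"
      using s(1) by (simp_all add: simple_functionD simple_function_level_set)
    note c = linear_on_Linf_simple[OF _ _ fin lev, where c = "\<lambda>r. r", folded g_def]
    have g: "g \<in> Linf M" "T g = T' g"
      using c[OF T(1,3)] c[OF T'(1,3)] unfolding g_def by auto
    have "supnorm M (\<lambda>x. g x - f x) \<le> min d d' / 2"
      using s d d' by (intro supnorm_le) (auto simp: g_def simple_function_eq_sum_indicator)
    then have "supnorm M (\<lambda>x. g x - f x) < d" "supnorm M (\<lambda>x. g x - f x) < d'"
      using d(1) d'(1) by linarith+
    then have "norm (T g - T f) < e / 2" "norm (T g - T' f) < e / 2"
      using d(2)[OF g(1)] d'(2)[OF g(1)] g(2) by auto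
    then show ?thesis
      using norm_triangle_ineq4[of "T g - T' f" "T g - T f"] by simp
  qed
  then have "norm (T f - T' f) \<le> 0" by (rule field_le_epsilon)
  then show ?thesis by simp
qed

lemma norm_le_all_eps_imp_zero:
  fixes v :: "'b::real_normed_vector"
  assumes "\<And>e. e > 0 \<Longrightarrow> norm v \<le> e * K"
  shows "v = 0"
proof -
  have "norm v \<le> 0 + e" if "e > 0" for e
  proof -
    \<comment> \<open>The denominator is positive whatever the sign of \<open>K\<close>, also for
      \<open>K = 0\<close>.\<close>
    have "norm v \<le> e / (\<bar>K\<bar> + 1) * K" using that by (intro assms) auto
    also have "\<dots> \<le> e / (\<bar>K\<bar> + 1) * (\<bar>K\<bar> + 1)" using that by (intro mult_left_mono) auto
    finally show ?thesis by simp
  qed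
  then have "norm v \<le> 0" by (rule field_le_epsilon)
  then show ?thesis by simp
qed

text \<open>All properties come from one estimate: if \<open>s\<close> is uniformly within
  \<open>C\<close> of \<open>f\<close>, then \<open>T f\<close> is within \<open>C * V\<close> of
  the elementary integral of \<open>s\<close>.\<close>

lemma ex_continuous_linear_on_Linf:
  assumes \<Omega>: "vector_measure M \<Omega>" "bounded_variation M \<Omega>"
  obtains T where "T \<in> extensional (Linf M)" "linear_on_Linf M T" "continuous_on_Linf M T"
    "\<forall>E\<in>sets M. T (indicator E) = \<Omega> E"
proof -
  define V where "V = enn2real (variation M \<Omega> (space M))"
  have V: "0 \<le> V" by (simp add: V_def)
  let ?S = "simple_vector_integral M \<Omega>"
  obtain T0 where T0: "\<And>f s C. f \<in> Linf M \<Longrightarrow> simple_function M s \<Longrightarrow> 0 \<le> C \<Longrightarrow>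
      (\<And>x. x \<in> space M \<Longrightarrow> \<bar>s x - f x\<bar> \<le> C) \<Longrightarrow> norm (T0 f - ?S s) \<le> C * V"
    using ex_vector_integral_value[OF \<Omega>] unfolding V_def by metis
  define T where "T = restrict T0 (Linf M)"
  have T: "norm (T f - ?S s) \<le> C * V"
    if "f \<in> Linf M" "simple_function M s" "0 \<le> C" "\<And>x. x \<in> space M \<Longrightarrow> \<bar>s x - f x\<bar> \<le> C" for f s C
    using T0[OF that] that(1) by (simp add: T_def)
  show thesis
  proof
    show "T \<in> extensional (Linf M)" by (simp add: T_def)
    show "\<forall>E\<in>sets M. T (indicator E) = \<Omega> E"
    proof
      fix E assume E: "E \<in> sets M"
      show "T (indicator E) = \<Omega> E"
        \<comment> \<open>An indicator is itself simple, so the approximation error is 0.\<close>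
        using T[of "indicator E" "indicator E" 0] E Linf_indicator[OF E]
          simple_vector_integral_indicator[OF \<Omega>(1) E] by (simp add: simple_function_indicator)
    qed
    show "linear_on_Linf M T"
      unfolding linear_on_Linf_def
    proof (intro conjI ballI allI)
      fix f g assume f: "f \<in> Linf M" and g: "g \<in> Linf M"
      have "norm (T (\<lambda>x. f x + g x) - (T f + T g)) \<le> e * (4 * V)" if e: "e > 0" for e
      proof -
        obtain s where s: "simple_function M s" "\<And>x. x \<in> space M \<Longrightarrow> \<bar>s x - f x\<bar> \<le> e"
          using Linf_approx_simple[OF f e] by blast
        obtain t where t: "simple_function M t" "\<And>x. x \<in> space M \<Longrightarrow> \<bar>t x - g x\<bar> \<le> e"
          using Linf_approx_simple[OF g e] by blast
        \<comment> \<open>The sum of the approximants is within \<open>2 * e\<close> of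
          \<open>f + g\<close>; with \<open>e\<close> for each summand the total error is
          \<open>4 * e * V\<close>.\<close>
        have "norm (T (\<lambda>x. f x + g x) - ?S (\<lambda>x. s x + t x)) \<le> (2 * e) * V"
        proof (rule T)
          show "\<bar>s x + t x - (f x + g x)\<bar> \<le> 2 * e" if "x \<in> space M" for x
            using s(2)[OF that] t(2)[OF that] by linarith
        qed (use f g e s t in \<open>auto intro: Linf_add simple_function_add\<close>)
        moreover have "norm ((T f - ?S s) + (T g - ?S t)) \<le> e * V + e * V"
          using f g e s t by (intro norm_triangle_mono T) auto
        moreover have "T (\<lambda>x. f x + g x) - (T f + T g) =
            (T (\<lambda>x. f x + g x) - ?S (\<lambda>x. s x + t x)) - ((T f - ?S s) + (T g - ?S t))"
          by (simp add: simple_vector_integral_add[OF \<Omega>(1) s(1) t(1)])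
        ultimately have "norm (T (\<lambda>x. f x + g x) - (T f + T g)) \<le> (2 * e) * V + (e * V + e * V)"
          by (simp only:) (rule order_trans[OF norm_triangle_ineq4], rule add_mono)
        then show ?thesis by (simp add: algebra_simps)
      qed
      then have "T (\<lambda>x. f x + g x) - (T f + T g) = 0"
        by (rule norm_le_all_eps_imp_zero)
      then show "T (\<lambda>x. f x + g x) = T f + T g" by simp
    next
      fix c f assume f: "f \<in> Linf M"
      have "norm (T (\<lambda>x. c * f x) - c *\<^sub>R T f) \<le> e * (2 * \<bar>c\<bar> * V)" if e: "e > 0" for e
      proof -
        obtain s where s: "simple_function M s" "\<And>x. x \<in> space M \<Longrightarrow> \<bar>s x - f x\<bar> \<le> e"
          using Linf_approx_simple[OF f e] by blast
        have "norm (T (\<lambda>x. c * f x) - ?S (\<lambda>x. c * s x)) \<le> (\<bar>c\<bar> * e) * V"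
        proof (rule T)
          show "\<bar>c * s x - c * f x\<bar> \<le> \<bar>c\<bar> * e" if "x \<in> space M" for x
            using s(2)[OF that] by (simp add: right_diff_distrib[symmetric] abs_mult mult_left_mono)
        qed (use f e s in \<open>auto intro: Linf_cmult simple_function_mult\<close>)
        moreover have "norm (T f - ?S s) \<le> e * V"
          using f e s by (auto intro!: T)
        then have "norm (c *\<^sub>R (T f - ?S s)) \<le> \<bar>c\<bar> * (e * V)"
          by (simp add: mult_left_mono)
        moreover have "T (\<lambda>x. c * f x) - c *\<^sub>R T f =
            (T (\<lambda>x. c * f x) - ?S (\<lambda>x. c * s x)) - c *\<^sub>R (T f - ?S s)"
          by (simp add: simple_vector_integral_scale[OF \<Omega>(1) s(1)] scaleR_diff_right)
        ultimately have "norm (T (\<lambda>x. c * f x) - c *\<^sub>R T f) \<le> (\<bar>c\<bar> * e) * V + \<bar>c\<bar> * (e * V)"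
          by (simp only:) (rule order_trans[OF norm_triangle_ineq4], rule add_mono)
        then show ?thesis by (simp add: algebra_simps)
      qed
      then have "T (\<lambda>x. c * f x) - c *\<^sub>R T f = 0"
        by (rule norm_le_all_eps_imp_zero)
      then show "T (\<lambda>x. c * f x) = c *\<^sub>R T f" by simp
    qed
    show "continuous_on_Linf M T"
      unfolding continuous_on_Linf_def
    proof (intro ballI allI impI)
      fix f and e :: real assume f: "f \<in> Linf M" and e: "e > 0"
      \<comment> \<open>One \<open>s\<close> within \<open>d\<close> of \<open>f\<close> is within
        \<open>2 * d\<close> of \<open>g\<close>, so the errors total \<open>3 * d * V\<close>. The
        summand 1 covers \<open>V = 0\<close> and makes the final inequality strict.\<close>
      define d where "d = e / (V + 1) / 3"
      have d: "d > 0" using V e by (simp add: d_def)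
      have "norm (T g - T f) < e" if g: "g \<in> Linf M" "supnorm M (\<lambda>x. g x - f x) < d" for g
      proof -
        obtain s where s: "simple_function M s" "\<And>x. x \<in> space M \<Longrightarrow> \<bar>s x - f x\<bar> \<le> d"
          using Linf_approx_simple[OF f d] by blast
        have "norm (T f - ?S s) \<le> d * V" using f d s by (auto intro!: T)
        moreover have "norm (T g - ?S s) \<le> (2 * d) * V"
        proof (rule T)
          fix x assume x: "x \<in> space M"
          show "\<bar>s x - g x\<bar> \<le> 2 * d"
            using s(2)[OF x] abs_le_supnorm[OF Linf_diff[OF g(1) f] x] g(2) by linarith
        qed (use g d s in auto)
        ultimately have "norm (T g - T f) \<le> 3 * d * V"
          using norm_triangle_ineq4[of "T g - ?S s" "T f - ?S s"] by simp
        also have "\<dots> < 3 * d * (V + 1)" using d by simp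
        also have "\<dots> = e" using V by (auto simp: d_def divide_simps)
        finally show ?thesis .
      qed
      then show "\<exists>\<delta>>0. \<forall>g\<in>Linf M. supnorm M (\<lambda>x. g x - f x) < \<delta> \<longrightarrow> norm (T g - T f) < e"
        using d by blast
    qed
  qed
qed

text \<open>Existence and uniqueness of the operator give the definite description its meaning.
  Indicators are the only integrands used from here on.\<close>

lemma vector_integral_indicator:
  assumes "vector_measure M \<Omega>" "bounded_variation M \<Omega>" and E: "E \<in> sets M"
  shows "vector_integral M \<Omega> (indicator E) = \<Omega> E"
proof -
  obtain T where T: "T \<in> extensional (Linf M)" "linear_on_Linf M T" "continuous_on_Linf M T"
    "\<forall>E\<in>sets M. T (indicator E) = \<Omega> E"
    using ex_continuous_linear_on_Linf[OF assms(1,2)] by metis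
  have "vector_integral M \<Omega> = T"
    unfolding vector_integral_def
  proof (rule the_equality)
    fix T' assume T': "T' \<in> extensional (Linf M) \<and> linear_on_Linf M T' \<and> continuous_on_Linf M T' \<and>
        (\<forall>E\<in>sets M. T' (indicator E) = \<Omega> E)"
    show "T' = T"
    proof (rule extensionalityI)
      fix f assume "f \<in> Linf M"
      with T T' show "T' f = T f"
        by (intro continuous_linear_on_Linf_unique[of M T' \<Omega> T f]) blast+
    qed (use T T' in auto)
  qed (use T in auto)
  then show ?thesis using T(4) E by simp
qed

subsection \<open>The Bochner integral\<close>

text \<open>Differences of Borel maps into a nonseparable space can fail to be Borel measurable.
  Here \<open>u\<close> has finitely many values, and for each fixed value the norm is a continuous
  function of \<open>f y\<close>.\<close>

lemma borel_measurable_norm_diff_simple: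
  fixes f u :: "'a \<Rightarrow> 'b::real_normed_vector"
  assumes f: "f \<in> borel_measurable M" and u: "simple_function M u"
  shows "(\<lambda>y. norm (f y - u y)) \<in> borel_measurable M"
proof (rule measurable_compose_countable'[where f = "\<lambda>c y. norm (f y - c)" and g = u and I = "u ` space M"])
  fix c :: 'b
  have "(\<lambda>x. norm (x - c)) \<in> borel_measurable borel"
    by (intro borel_measurable_continuous_onI continuous_intros)
  then show "(\<lambda>y. norm (f y - c)) \<in> borel_measurable M"
    using f by (rule measurable_compose[rotated])
next
  show "u \<in> M \<rightarrow>\<^sub>M count_space (u ` space M)"
    using u by (auto simp: measurable_count_space_eq2 simple_functionD)
  show "countable (u ` space M)"
    using u by (simp add: simple_functionD countable_finite)
qed

lemma simple_bochner_integral_indicator_scaleR: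
  assumes "finite_measure M" "F \<in> sets M"
  shows "Bochner_Integration.simple_bochner_integrable M (\<lambda>y. indicator F y *\<^sub>R c)"
    and "Bochner_Integration.simple_bochner_integral M (\<lambda>y. indicator F y *\<^sub>R c) = measure M F *\<^sub>R c"
proof -
  interpret finite_measure M by fact
  have i: "Bochner_Integration.simple_bochner_integrable M (indicator F :: _ \<Rightarrow> real)"
    using assms by (intro simple_bochner_integrable.intros) auto
  then show "Bochner_Integration.simple_bochner_integrable M (\<lambda>y. indicator F y *\<^sub>R c)"
    by (rule simple_bochner_integrable_compose2[where p = "\<lambda>s _. s *\<^sub>R c", rotated]) (use i in auto)
  \<comment> \<open>The real-valued case is settled first; the linear map sending \<open>t\<close>
    to \<open>t *\<^sub>R c\<close> then carries it over to vectors.\<close>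
  have "ennreal (Bochner_Integration.simple_bochner_integral M (indicator F)) = ennreal (measure M F)"
    using assms by (subst simple_bochner_integral_eq_nn_integral[OF i])
      (auto simp: ennreal_indicator emeasure_eq_measure)
  then have "Bochner_Integration.simple_bochner_integral M (indicator F) = measure M F"
    by (subst (asm) ennreal_inj) (auto intro: simple_bochner_integral_nonneg)
  then show "Bochner_Integration.simple_bochner_integral M (\<lambda>y. indicator F y *\<^sub>R c) = measure M F *\<^sub>R c"
    using simple_bochner_integral_linear[OF _ i, of "\<lambda>t. t *\<^sub>R c"] by (simp add: linear_scale_left)
qed

text \<open>The integral of \<open>f - g\<close> is zero, while \<open>close\<close> puts
  \<open>f - g\<close> within \<open>r\<close> of \<open>c\<close> on \<open>F\<close> and makes it
  vanish almost everywhere off \<open>F\<close>; so \<open>c\<close> times the measure of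
  \<open>F\<close> has norm at most \<open>r\<close> times that measure. The argument runs through
  the simple approximants, whose differences are again simple.\<close>

lemma norm_le_if_Bochner_integrals_eq:
  assumes "finite_measure N"
    and f: "has_Bochner_integral N f w" and g: "has_Bochner_integral N g w"
    and F: "F \<in> sets N" and "0 \<le> r"
    and close: "AE y in N. norm (f y - g y - indicator F y *\<^sub>R c) \<le> r * indicator F y"
  shows "norm c * measure N F \<le> r * measure N F"
proof -
  interpret finite_measure N by fact
  let ?I = "Bochner_Integration.simple_bochner_integral N"
  obtain u where u: "\<And>i. Bochner_Integration.simple_bochner_integrable N (u i)"
      "(\<lambda>i. \<integral>\<^sup>+ y. ennreal (norm (f y - u i y)) \<partial>completion N) \<longlonglongrightarrow> 0" "(\<lambda>i. ?I (u i)) \<longlonglongrightarrow> w"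
    using f unfolding has_Bochner_integral_def by auto
  obtain v where v: "\<And>i. Bochner_Integration.simple_bochner_integrable N (v i)"
      "(\<lambda>i. \<integral>\<^sup>+ y. ennreal (norm (g y - v i y)) \<partial>completion N) \<longlonglongrightarrow> 0" "(\<lambda>i. ?I (v i)) \<longlonglongrightarrow> w"
    using g unfolding has_Bochner_integral_def by auto
  have sf: "simple_function N (u i)" "simple_function N (v i)" for i
    using u(1)[of i] v(1)[of i] by (auto elim: simple_bochner_integrable.cases)
  have [measurable]: "(\<lambda>y. norm (f y - u i y)) \<in> borel_measurable (completion N)"
    "(\<lambda>y. norm (g y - v i y)) \<in> borel_measurable (completion N)" for i
    using f g sf unfolding has_Bochner_integral_def strongly_measurable_def
    by (auto intro!: borel_measurable_norm_diff_simple simple_function_completion)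
  note [measurable] = sets_completionI_sets[OF F]
  note ind = simple_bochner_integral_indicator_scaleR[OF assms(1) F, of c]
  let ?b = "\<lambda>i. (\<integral>\<^sup>+ y. norm (f y - u i y) \<partial>completion N) + (\<integral>\<^sup>+ y. norm (g y - v i y) \<partial>completion N)
      + ennreal (r * measure N F)"
  have bound: "ennreal (norm (?I (u i) - ?I (v i) - measure N F *\<^sub>R c)) \<le> ?b i" for i
  proof -
    let ?h = "\<lambda>y. u i y - v i y - indicator F y *\<^sub>R c"
    have uv: "Bochner_Integration.simple_bochner_integrable N (\<lambda>y. u i y - v i y)"
      using u v by (intro simple_bochner_integrable_compose2[where p = minus]) auto
    then have h: "Bochner_Integration.simple_bochner_integrable N ?h"
      using ind(1) by (rule simple_bochner_integrable_compose2[where p = minus, rotated]) simp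
    then have nh: "Bochner_Integration.simple_bochner_integrable N (\<lambda>y. norm (?h y))"
      using h by (rule simple_bochner_integrable_compose2[where p = "\<lambda>s _. norm s", rotated]) auto
    have "?I ?h = ?I (u i) - ?I (v i) - measure N F *\<^sub>R c"
      using u v uv ind by (simp add: simple_bochner_integral_diff)
    then have "ennreal (norm (?I (u i) - ?I (v i) - measure N F *\<^sub>R c)) \<le> ennreal (?I (\<lambda>y. norm (?h y)))"
      using simple_bochner_integral_norm_bound[OF h] by (simp add: ennreal_leI)
    \<comment> \<open>Over the completion the approximation errors of \<open>f\<close> and
      \<open>g\<close> are measurable, as additivity of the integral requires below.\<close>
    also have "\<dots> = (\<integral>\<^sup>+ y. norm (?h y) \<partial>completion N)"
      using simple_bochner_integral_eq_nn_integral[OF nh] by (simp add: nn_integral_completion)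
    also have "\<dots> \<le> (\<integral>\<^sup>+ y. ennreal (norm (f y - u i y)) + ennreal (norm (g y - v i y))
        + ennreal (r * indicator F y) \<partial>completion N)"
    proof (rule nn_integral_mono_AE)
      show "AE y in completion N. ennreal (norm (?h y)) \<le>
          ennreal (norm (f y - u i y)) + ennreal (norm (g y - v i y)) + ennreal (r * indicator F y)"
        using AE_completion[OF close]
      proof eventually_elim
        case (elim y)
        \<comment> \<open>Replacing \<open>f\<close> and \<open>g\<close> by their approximants
          costs the two approximation errors; the remaining term is controlled by
          \<open>close\<close>.\<close>
        have "?h y = (f y - g y - indicator F y *\<^sub>R c) - ((f y - u i y) - (g y - v i y))"
          by simp
        then have "norm (?h y) \<le> norm (f y - g y - indicator F y *\<^sub>R c)
            + (norm (f y - u i y) + norm (g y - v i y))"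
          by (simp only:) (rule order_trans[OF norm_triangle_ineq4], rule add_mono[OF order_refl norm_triangle_ineq4])
        also have "\<dots> \<le> norm (f y - u i y) + norm (g y - v i y) + r * indicator F y"
          using elim by simp
        finally show ?case
          using \<open>0 \<le> r\<close> by (simp flip: ennreal_plus add: ennreal_leI)
      qed
    qed
    also have "\<dots> = (\<integral>\<^sup>+ y. norm (f y - u i y) \<partial>completion N) + (\<integral>\<^sup>+ y. norm (g y - v i y) \<partial>completion N)
      + (\<integral>\<^sup>+ y. ennreal (r * indicator F y) \<partial>completion N)"
      by (simp add: nn_integral_add)
    also have "(\<integral>\<^sup>+ y. ennreal (r * indicator F y) \<partial>completion N) = ennreal (r * measure N F)"
      using F \<open>0 \<le> r\<close> by (simp add: ennreal_mult ennreal_indicator nn_integral_cmult emeasure_eq_measure)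
    finally show ?thesis .
  qed
  \<comment> \<open>Both sequences of integrals tend to the same \<open>w\<close>, so in the limit
    only the term with \<open>c\<close> survives.\<close>
  have "(\<lambda>i. ennreal (norm (?I (u i) - ?I (v i) - measure N F *\<^sub>R c)))
      \<longlonglongrightarrow> ennreal (norm (w - w - measure N F *\<^sub>R c))"
    by (intro tendsto_intros tendsto_ennrealI u v)
  moreover have "?b \<longlonglongrightarrow> 0 + 0 + ennreal (r * measure N F)"
    by (intro tendsto_intros u v)
  ultimately have "ennreal (norm (w - w - measure N F *\<^sub>R c)) \<le> 0 + 0 + ennreal (r * measure N F)"
    by (rule LIMSEQ_le) (use bound in blast)
  then show ?thesis
    using \<open>0 \<le> r\<close> by (simp add: ennreal_le_iff mult.commute)
qed

text \<open>
  The values of the approximating simple functions form countable sets. If \<open>g y \<noteq> g' y\<close>, then for some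
  such values \<open>a \<noteq> b\<close> both \<open>g y\<close> is within \<open>norm (a - b) / 4\<close> of \<open>a\<close> and \<open>g' y\<close> of \<open>b\<close>; on the set of
  these \<open>y\<close> the difference \<open>g - g'\<close> is within \<open>norm (a - b) / 2\<close> of \<open>a - b\<close> while its integral vanishes,
  so the set is null. The two balls are treated separately because \<open>g - g'\<close> need not be Borel
  measurable when the target is not separable.
\<close>

lemma AE_eq_if_Bochner_integrals_eq:
  assumes "finite_measure N"
    and g: "strongly_measurable N g" and g': "strongly_measurable N g'"
    and int: "\<And>F. F \<in> sets N \<Longrightarrow> \<exists>f f' w. has_Bochner_integral N f w \<and> has_Bochner_integral N f' w \<and>
      (AE y in N. f y = indicator F y *\<^sub>R g y) \<and> (AE y in N. f' y = indicator F y *\<^sub>R g' y)"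
  shows "AE y in N. g y = g' y"
proof -
  interpret finite_measure N by fact
  obtain s where s: "\<And>i. Bochner_Integration.simple_bochner_integrable N (s i)"
      "AE y in N. (\<lambda>i. s i y) \<longlonglongrightarrow> g y"
    using g unfolding strongly_measurable_def by auto
  obtain s' where s': "\<And>i. Bochner_Integration.simple_bochner_integrable N (s' i)"
      "AE y in N. (\<lambda>i. s' i y) \<longlonglongrightarrow> g' y"
    using g' unfolding strongly_measurable_def by auto
  define D where "D = (\<Union>i. s i ` space N)"
  define D' where "D' = (\<Union>i. s' i ` space N)"
  have "finite (s i ` space N)" "finite (s' i ` space N)" for i
    using s(1)[of i] s'(1)[of i] by (auto elim!: simple_bochner_integrable.cases dest: simple_functionD(1))
  then have D: "countable D" "countable D'"
    unfolding D_def D'_def by (simp_all add: countable_finite)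
  have off: "AE y in N. \<not> (norm (g y - a) < norm (a - b) / 4 \<and> norm (g' y - b) < norm (a - b) / 4)"
    for a b
  proof (cases "a = b")
    case False
    define K where "K = {y\<in>space N. norm (g y - a) < norm (a - b) / 4 \<and> norm (g' y - b) < norm (a - b) / 4}"
    have [measurable]: "(\<lambda>y. norm (g y - a)) \<in> borel_measurable (completion N)"
        "(\<lambda>y. norm (g' y - b)) \<in> borel_measurable (completion N)"
      using g g' borel_measurable_norm_diff_simple[of _ "completion N" "\<lambda>_. _"]
      unfolding strongly_measurable_def by auto
    have "{y\<in>space (completion N). norm (g y - a) < norm (a - b) / 4 \<and> norm (g' y - b) < norm (a - b) / 4}
        \<in> sets (completion N)"
      by measurable
    then have K: "K \<in> sets (completion N)" by (simp add: K_def)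
    \<comment> \<open>\<open>K\<close> is measurable only for the completion, whereas
      \<open>int\<close> speaks of sets of \<open>N\<close>; the main part lies inside
      \<open>K\<close> and differs from it by a null set.\<close>
    define F where "F = main_part N K"
    have F: "F \<in> sets N" using K by (simp add: F_def)
    have "F \<subseteq> K" using main_part_null_part_Un[OF K] by (auto simp: F_def)
    obtain f f' w where w: "has_Bochner_integral N f w" "has_Bochner_integral N f' w"
        "AE y in N. f y = indicator F y *\<^sub>R g y" "AE y in N. f' y = indicator F y *\<^sub>R g' y"
      using int[OF F] by auto
    have "AE y in N. norm (f y - f' y - indicator F y *\<^sub>R (a - b)) \<le> norm (a - b) / 2 * indicator F y"
      using w(3,4)
    proof eventually_elim
      case (elim y)
      show ?case
      proof (cases "y \<in> F")
        case True
        then have "norm (g y - a) < norm (a - b) / 4" "norm (g' y - b) < norm (a - b) / 4"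
          using \<open>F \<subseteq> K\<close> by (auto simp: K_def)
        moreover have "norm (g y - g' y - (a - b)) \<le> norm (g y - a) + norm (g' y - b)"
          using norm_triangle_ineq4[of "g y - a" "g' y - b"] by (simp add: algebra_simps)
        ultimately have "norm (g y - g' y - (a - b)) \<le> norm (a - b) / 2" by linarith
        then show ?thesis using True elim by simp
      qed (use elim in simp)
    qed
    then have "norm (a - b) * measure N F \<le> norm (a - b) / 2 * measure N F"
      by (intro norm_le_if_Bochner_integrals_eq[OF assms(1) w(1,2) F]) auto
    \<comment> \<open>As \<open>a \<noteq> b\<close>, the factor \<open>norm (a - b)\<close> is
      strictly larger than its half.\<close>
    then have "measure N F = 0"
      using False measure_nonneg[of N F] by (auto simp: mult_le_cancel_right)
    then have "F \<in> null_sets N" using F by (simp add: null_sets_def emeasure_eq_measure)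
    then have "AE y in N. y \<notin> F" by (rule AE_not_in)
    with AE_notin_null_part[OF K] AE_space show ?thesis
    proof eventually_elim
      case (elim y)
      then have "y \<notin> K" using main_part_null_part_Un[OF K] by (auto simp: F_def)
      then show ?case using elim by (auto simp: K_def)
    qed
  qed auto
  \<comment> \<open>Countability of \<open>D\<close> and \<open>D'\<close> merges the exceptional
    null sets of all pairs into one.\<close>
  have "AE y in N. \<forall>a\<in>D. \<forall>b\<in>D'. \<not> (norm (g y - a) < norm (a - b) / 4 \<and> norm (g' y - b) < norm (a - b) / 4)"
    using off D by (simp add: AE_ball_countable)
  with s(2) s'(2) AE_space show ?thesis
  proof eventually_elim
    case (elim y)
    show ?case
    proof (rule ccontr)
      assume "g y \<noteq> g' y"
      define d where "d = norm (g y - g' y)"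
      \<comment> \<open>If both approximants are within \<open>d / 8\<close>, they are more than
        \<open>3 * d / 4\<close> apart, and a quarter of that distance still exceeds
        \<open>d / 8\<close>; so the excluded configuration occurs.\<close>
      have "d / 8 > 0" using \<open>g y \<noteq> g' y\<close> by (simp add: d_def)
      with elim(1,2) have "\<forall>\<^sub>F i in sequentially. dist (s i y) (g y) < d / 8"
          "\<forall>\<^sub>F i in sequentially. dist (s' i y) (g' y) < d / 8"
        by (blast dest: tendstoD)+
      then have "\<forall>\<^sub>F i in sequentially. dist (s i y) (g y) < d / 8 \<and> dist (s' i y) (g' y) < d / 8"
        by (rule eventually_conj)
      then obtain i where i: "norm (g y - s i y) < d / 8" "norm (g' y - s' i y) < d / 8"
        using eventually_happens'[OF sequentially_bot] by (auto simp: dist_norm norm_minus_commute)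
      have "g y - g' y = (s i y - s' i y) + ((g y - s i y) - (g' y - s' i y))" by simp
      then have "d \<le> norm (s i y - s' i y) + (norm (g y - s i y) + norm (g' y - s' i y))"
        unfolding d_def
        by (simp only:) (rule order_trans[OF norm_triangle_ineq], rule add_mono[OF order_refl norm_triangle_ineq4])
      then have "d / 8 \<le> norm (s i y - s' i y) / 4" using i \<open>d / 8 > 0\<close> by linarith
      then have "norm (g y - s i y) < norm (s i y - s' i y) / 4 \<and> norm (g' y - s' i y) < norm (s i y - s' i y) / 4"
        using i by linarith
      moreover have "s i y \<in> D" "s' i y \<in> D'" using elim(3) by (auto simp: D_def D'_def)
      ultimately show False using elim(4) by blast
    qed
  qed
qed

subsection \<open>Uniqueness of disintegrations\<close>

text \<open>
  If \<open>variation M \<Omega>\<close> were not countably additive, \<open>measure_of\<close> would give the zero measure, which is finite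
  as well; so countable additivity of the variation plays no role.
\<close>

lemma finite_measure_variation_measure:
  assumes "bounded_variation M \<Omega>"
  shows "finite_measure (variation_measure M \<Omega>)"
proof
  show "emeasure (variation_measure M \<Omega>) (space (variation_measure M \<Omega>)) \<noteq> \<infinity>"
    using assms unfolding variation_measure_def bounded_variation_def
    by (auto simp: emeasure_measure_of_conv space_measure_of sets.space_closed)
qed

lemma sets_variation_measure: "sets (variation_measure M \<Omega>) = sets M"
  by (simp add: variation_measure_def)

text \<open>The variation dominates the norm, so measurable sets missing \<open>Z\<close> have
  measure zero. If \<open>Z\<close> lies in \<open>F\<close>, then \<open>E\<close> and
  \<open>E \<inter> F\<close> differ by such a set; if \<open>Z\<close> misses \<open>F\<close>,
  then \<open>E \<inter> F\<close> is one.\<close>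

lemma vector_measure_concentrated_Int:
  assumes "vector_measure M \<Omega>" "variation M \<Omega> (space M - Z) = 0"
    and "Z \<in> sets M" "E \<in> sets M" "F \<in> sets M"
  shows "Z \<subseteq> F \<Longrightarrow> \<Omega> (E \<inter> F) = \<Omega> E" "Z \<inter> F = {} \<Longrightarrow> \<Omega> (E \<inter> F) = 0"
proof -
  have null: "\<Omega> A = 0" if "A \<in> sets M" "A \<inter> Z = {}" for A
    using norm_le_variation[OF assms(1), of A "space M - Z"] that assms sets.sets_into_space[OF that(1)]
    by auto
  show "\<Omega> (E \<inter> F) = 0" if "Z \<inter> F = {}"
    using that assms by (intro null) auto
  show "\<Omega> (E \<inter> F) = \<Omega> E" if "Z \<subseteq> F"
  proof -
    have "\<Omega> (E - E \<inter> F) = \<Omega> E - \<Omega> (E \<inter> F)"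
      using assms by (intro vector_measure_Diff[OF assms(1)]) auto
    moreover have "\<Omega> (E - E \<inter> F) = 0"
      using that assms by (intro null) auto
    ultimately show ?thesis by simp
  qed
qed

text \<open>The fibre over \<open>y\<close> lies inside the preimage of \<open>F\<close> if
  \<open>y \<in> F\<close> and misses it otherwise. Cutting \<open>E\<close> down to that preimage
  therefore multiplies the fibre integral by the indicator of \<open>F\<close>, which localises the
  disintegration formula to \<open>F\<close>.\<close>

lemma disintegration_Int_vimage:
  assumes \<phi>: "\<phi> \<in> X \<rightarrow>\<^sub>M Y" and dis: "disintegration X Y \<phi> \<Omega> \<Omega>y"
    and \<Omega>: "vector_measure X \<Omega>" "bounded_variation X \<Omega>"
    and E: "E \<in> sets X" and F: "F \<in> sets Y"
  defines "\<nu> \<equiv> distr (variation_measure X \<Omega>) Y \<phi>" and "A \<equiv> E \<inter> (\<phi> -` F \<inter> space X)"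
  shows "has_Bochner_integral \<nu> (\<lambda>y. vector_integral X (\<Omega>y y) (indicator A)) (\<Omega> A)"
    and "AE y in \<nu>. vector_integral X (\<Omega>y y) (indicator A) =
      indicator F y *\<^sub>R vector_integral X (\<Omega>y y) (indicator E)"
proof -
  have \<phi>F: "\<phi> -` F \<inter> space X \<in> sets X" using \<phi> F by (rule measurable_sets)
  then have A: "A \<in> sets X" using E by (simp add: A_def)
  have vm: "vector_measure X (\<Omega>y y)" "bounded_variation X (\<Omega>y y)" if "y \<in> space Y" for y
    using dis that by (auto simp: disintegration_def Let_def)
  have "has_Bochner_integral \<nu> (\<lambda>y. vector_integral X (\<Omega>y y) (indicator A)) (vector_integral X \<Omega> (indicator A))"
    using dis Linf_indicator[OF A] by (auto simp: disintegration_def Let_def \<nu>_def)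
  then show "has_Bochner_integral \<nu> (\<lambda>y. vector_integral X (\<Omega>y y) (indicator A)) (\<Omega> A)"
    by (simp add: vector_integral_indicator[OF \<Omega> A])
  have "AE y in \<nu>. variation X (\<Omega>y y) (space X) = 1 \<and> {y} \<in> sets Y \<and>
      variation X (\<Omega>y y) (space X - \<phi> -` {y}) = 0"
    using dis unfolding \<nu>_def disintegration_def Let_def by (elim conjE)
  with AE_space show "AE y in \<nu>. vector_integral X (\<Omega>y y) (indicator A) =
      indicator F y *\<^sub>R vector_integral X (\<Omega>y y) (indicator E)"
  proof eventually_elim
    case (elim y)
    then have y: "y \<in> space Y" by (simp add: \<nu>_def)
    let ?Z = "\<phi> -` {y} \<inter> space X"
    have Z: "?Z \<in> sets X" using \<phi> elim by (intro measurable_sets) auto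
    have "space X - \<phi> -` {y} = space X - ?Z" by auto
    then have "variation X (\<Omega>y y) (space X - ?Z) = 0" using elim by simp
    note c = vector_measure_concentrated_Int[OF vm(1)[OF y] this Z E \<phi>F, folded A_def]
    have "\<Omega>y y A = \<Omega>y y E" if "y \<in> F" by (rule c(1)) (use that in auto)
    moreover have "\<Omega>y y A = 0" if "y \<notin> F" by (rule c(2)) (use that in auto)
    ultimately show ?case
      by (cases "y \<in> F") (simp_all add: vector_integral_indicator[OF vm[OF y]] A E)
  qed
qed

theorem lemma5p7:
  fixes \<phi> :: "'x::polish_space \<Rightarrow> 'y::polish_space"
    and \<Omega> :: "'x set \<Rightarrow> 'b::banach"
    and \<Omega>y \<Omega>y' :: "'y \<Rightarrow> 'x set \<Rightarrow> 'b"
  assumes "\<phi> \<in> borel \<rightarrow>\<^sub>M borel"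
    and "vector_measure borel \<Omega>"
    and "bounded_variation borel \<Omega>"
    and "disintegration borel borel \<phi> \<Omega> \<Omega>y"
    and "disintegration borel borel \<phi> \<Omega> \<Omega>y'"
  shows "AE y in distr (variation_measure borel \<Omega>) borel \<phi>.
           \<forall>E \<in> sets borel. \<Omega>y y E = \<Omega>y' y E"
proof -
  define \<nu> where "\<nu> = distr (variation_measure borel \<Omega>) borel \<phi>"
  have "\<phi> \<in> variation_measure borel \<Omega> \<rightarrow>\<^sub>M borel"
    using assms(1) by (simp add: measurable_cong_sets[OF sets_variation_measure refl])
  then have fin: "finite_measure \<nu>"
    unfolding \<nu>_def
    by (rule finite_measure.finite_measure_distr[OF finite_measure_variation_measure[OF assms(3)]])
  \<comment> \<open>These hold for every \<open>y\<close>, since the space of \<open>borel\<close>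
    is the whole type.\<close>
  have vm: "vector_measure borel (\<Omega>y y)" "bounded_variation borel (\<Omega>y y)"
      "vector_measure borel (\<Omega>y' y)" "bounded_variation borel (\<Omega>y' y)" for y
    using assms(4,5) by (auto simp: disintegration_def Let_def)
  have eq: "AE y in \<nu>. \<Omega>y y E = \<Omega>y' y E" if E: "E \<in> sets borel" for E
  proof -
    let ?g = "\<lambda>y A. vector_integral borel (\<Omega>y y) (indicator A)"
    let ?g' = "\<lambda>y A. vector_integral borel (\<Omega>y' y) (indicator A)"
    have "AE y in \<nu>. ?g y E = ?g' y E"
    proof (rule AE_eq_if_Bochner_integrals_eq[OF fin])
      show "strongly_measurable \<nu> (\<lambda>y. ?g y E)" "strongly_measurable \<nu> (\<lambda>y. ?g' y E)"
        using assms(4,5) Linf_indicator[OF E] by (auto simp: disintegration_def Let_def \<nu>_def)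
      fix F assume "F \<in> sets \<nu>"
      then have F: "F \<in> sets borel" by (simp add: \<nu>_def)
      \<comment> \<open>The common \<open>w\<close> is the value of \<open>\<Omega>\<close> on
        \<open>E\<close> intersected with the preimage of \<open>F\<close>, which both
        disintegrations recover.\<close>
      show "\<exists>f f' w. has_Bochner_integral \<nu> f w \<and> has_Bochner_integral \<nu> f' w \<and>
          (AE y in \<nu>. f y = indicator F y *\<^sub>R ?g y E) \<and> (AE y in \<nu>. f' y = indicator F y *\<^sub>R ?g' y E)"
        using disintegration_Int_vimage[OF assms(1,4,2,3) E F, folded \<nu>_def]
          disintegration_Int_vimage[OF assms(1,5,2,3) E F, folded \<nu>_def] by blast
    qed
    then show ?thesis by (simp add: vector_integral_indicator vm E)
  qed
  obtain G :: "'x set set" where G: "countable G" "Int_stable G" "UNIV \<in> G" "sets borel = sigma_sets UNIV G"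
    using borel_countable_Int_stable_generator .
  \<comment> \<open>The null set in \<open>eq\<close> depends on the set tested; countability of
    \<open>G\<close> provides a single one for the whole generator.\<close>
  have "AE y in \<nu>. \<forall>A\<in>G. \<Omega>y y A = \<Omega>y' y A"
    using G by (auto simp: AE_ball_countable intro!: eq)
  then show ?thesis
    unfolding \<nu>_def[symmetric]
  proof eventually_elim
    case (elim y)
    have gen: "G \<subseteq> Pow (space borel)" "space borel \<in> G" "sets borel = sigma_sets (space borel) G"
      using G(3,4) by simp_all
    show ?case
      using vector_measure_eqI_generator[OF vm(1,3) G(2) gen] elim by blast
  qed
qed

end
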